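(* Let $\mathcal{K}=\langle K_1,\dots,K_r\rangle$ be an Alexander $r$-tuple of simplicial complexes $K_i\subsetneq 2^V$ on a finite vertex set $V$. Then one of the following holds: (1) $r=2$ and $(K_1,K_2)=(K,K^\circ)$ is an Alexander pair of dual complexes; or (2) $r\ge 3$ and, up to a bijection of $V$ with $[n]$, where $n=|V|$, there are non-negative integers $m_1,\dots,m_r$ with $n=m_1+\cdots+m_r+r-1$ and $K_i=\binom{[n]}{\leqslant m_i}$ for each $i=1,\dots,r$; or (3) $r\ge 3$ and, up to a bijection of $V$ with $[n]\cup C$ for some $n$ and some non-empty set $C$ with $C\cap[n]=\emptyset$, there are non-negative integers $m_1,\dots,m_r$ with $n=m_1+\cdots+m_r+r-1$ and $K_i=\binom{[n]}{\leqslant m_i}\ast\Delta(C)$ for each $i=1,\dots,r$, where $\Delta(C)=2^C$ is the simplex spanned by $C$.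
   Context: $[n]=\{1,\dots,n\}$. A simplicial complex on a finite vertex set $V$ is a subset $K\subseteq 2^V$ with $\emptyset\in K$ that is closed under taking subsets (some $\{v\}$, $v\in V$, may fail to be in $K$). All complexes are assumed proper: $K_i\subsetneq 2^V$. An $r$-tuple $\langle K_1,\dots,K_r\rangle$ of complexes on $V$ is collective $r$-unavoidable if for each ordered collection $(A_1,\dots,A_r)$ of pairwise disjoint subsets of $V$ there exists $i$ with $A_i\in K_i$. It is an Alexander $r$-tuple if it is collective $r$-unavoidable and, for all $A_1\in K_1,\dots,A_r\in K_r$, the set $V\setminus\bigcup_{i=1}^r A_i$ has at least $r-1$ elements. The Alexander dual of $K\subsetneq 2^V$ is $K^\circ=\{F\subseteq V\mid V\setminus F\notin K\}$. $\binom{[n]}{\leqslant m}$ is the complex of all subsets of $[n]$ of cardinality at most $m$. The join of complexes $K,L$ on disjoint vertex sets is $K\ast L=\{A\cup B\mid A\in K, B\in L\}$. *)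

theory Defs
  imports Main "HOL-Library.Disjoint_Sets"
begin

text \<open>
  The vertex set is a carrier set, and elements of it need not be
  vertices (singleton faces) of the complex.
\<close>

definition simplicial_complex :: "'a set \<Rightarrow> 'a set set \<Rightarrow> bool" where
  "simplicial_complex V K \<longleftrightarrow>
     K \<subseteq> Pow V \<and> {} \<in> K \<and> (\<forall>A\<in>K. \<forall>B. B \<subseteq> A \<longrightarrow> B \<in> K)"

text \<open>
  An \<open>r\<close>-tuple is a function on \<open>nat\<close> of which only the values
  at \<open>1, \<dots>, r\<close> matter.
\<close>

definition collective_unavoidable :: "'a set \<Rightarrow> nat \<Rightarrow> (nat \<Rightarrow> 'a set set) \<Rightarrow> bool" where
  "collective_unavoidable V r K \<longleftrightarrow>
     (\<forall>A. (\<forall>i\<in>{1..r}. A i \<subseteq> V) \<and> disjoint_family_on A {1..r}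
        \<longrightarrow> (\<exists>i\<in>{1..r}. A i \<in> K i))"

definition alexander_tuple :: "'a set \<Rightarrow> nat \<Rightarrow> (nat \<Rightarrow> 'a set set) \<Rightarrow> bool" where
  "alexander_tuple V r K \<longleftrightarrow>
     collective_unavoidable V r K \<and>
     (\<forall>A. (\<forall>i\<in>{1..r}. A i \<in> K i) \<longrightarrow> card (V - (\<Union>i\<in>{1..r}. A i)) \<ge> r - 1)"

definition alexander_dual :: "'a set \<Rightarrow> 'a set set \<Rightarrow> 'a set set" where
  "alexander_dual V K = {F. F \<subseteq> V \<and> V - F \<notin> K}"

definition subsets_upto :: "nat \<Rightarrow> nat \<Rightarrow> nat set set" where
  "subsets_upto n m = {A. A \<subseteq> {1..n} \<and> card A \<le> m}"

text \<open>Only meaningful for complexes on disjoint vertex sets.\<close>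

definition join :: "'a set set \<Rightarrow> 'a set set \<Rightarrow> 'a set set" where
  "join K L = {A \<union> B | A B. A \<in> K \<and> B \<in> L}"

end

theory Submission
  imports Defs
begin

text \<open>
  For \<open>r \<ge> 3\<close>, encode a tuple of disjoint faces \<open>A\<^sub>i \<in> K\<^sub>i\<close> as a colouring of \<open>V\<close>, where the
  colour \<open>0\<close> marks the uncovered set \<open>R\<close>. Faces can be enlarged until \<open>|R| = r - 1\<close>, and then
  no \<open>A\<^sub>i\<close> can be enlarged by a vertex of \<open>R\<close>. In such a full colouring, every covered vertex
  \<open>x \<in> A\<^sub>i\<close> is of exactly one of two kinds: either \<open>x\<close> can be moved to every other \<open>A\<^sub>j\<close> (\<open>x\<close> is
  free), or \<open>x\<close> can be exchanged with every \<open>v \<in> R\<close>. As \<open>r \<ge> 3\<close>, for each such modification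
  there is a third colour class witnessing that the other free vertices stay free. So the set
  of free vertices is invariant, free vertices can be recoloured at will, and the colours of the
  remaining vertices can be permuted at will. Hence \<open>F \<in> K\<^sub>i\<close> depends only on the number of
  non-free vertices in \<open>F\<close>.
\<close>

lemma card_exchange: "finite A \<Longrightarrow> v \<in> A \<Longrightarrow> x \<notin> A \<Longrightarrow> card (insert x (A - {v})) = card A"
  by (metis Diff_iff card.remove card_insert_disjoint finite_Diff)

section \<open>Colourings of the vertex set by disjoint faces\<close>

locale alexander_complexes =
  fixes V :: "'a set" and r :: nat and K :: "nat \<Rightarrow> 'a set set"
  assumes finite_V: "finite V"
    and complex: "\<And>i. i \<in> {1..r} \<Longrightarrow> simplicial_complex V (K i)"
    and alexander: "alexander_tuple V r K"
    and r_ge_3: "r \<ge> 3"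
begin

definition cls :: "('a \<Rightarrow> nat) \<Rightarrow> nat \<Rightarrow> 'a set" where
  "cls f i = {x \<in> V. f x = i}"

definition face_colouring :: "('a \<Rightarrow> nat) \<Rightarrow> bool" where
  "face_colouring f \<longleftrightarrow> (\<forall>x\<in>V. f x \<le> r) \<and> (\<forall>i\<in>{1..r}. cls f i \<in> K i)"

definition full :: "('a \<Rightarrow> nat) \<Rightarrow> bool" where
  "full f \<longleftrightarrow> face_colouring f \<and> card (cls f 0) = r - 1"

text \<open>For a face colouring the condition at \<open>j = f x\<close> holds automatically. For a
  full one, \<open>in_free_iff\<close> reduces the others to any single
  \<open>j \<noteq> f x\<close>.\<close>

definition free :: "('a \<Rightarrow> nat) \<Rightarrow> 'a set" where
  "free f = {x \<in> V. f x \<noteq> 0 \<and> (\<forall>j\<in>{1..r}. insert x (cls f j) \<in> K j)}"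

lemma face_subset: "i \<in> {1..r} \<Longrightarrow> A \<in> K i \<Longrightarrow> B \<subseteq> A \<Longrightarrow> B \<in> K i"
  using complex unfolding simplicial_complex_def by blast

lemma face_subset_V: "i \<in> {1..r} \<Longrightarrow> A \<in> K i \<Longrightarrow> A \<subseteq> V"
  using complex unfolding simplicial_complex_def by blast

lemma empty_face: "i \<in> {1..r} \<Longrightarrow> {} \<in> K i"
  using complex unfolding simplicial_complex_def by blast

lemma finite_cls [simp]: "finite (cls f i)"
  using finite_V by (simp add: cls_def)

lemma unavoidable:
  assumes "\<And>i. i \<in> {1..r} \<Longrightarrow> A i \<subseteq> V" and "disjoint_family_on A {1..r}"
  shows "\<exists>i\<in>{1..r}. A i \<in> K i"
  using alexander assms unfolding alexander_tuple_def collective_unavoidable_def by blast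

lemma card_uncovered_ge:
  assumes "face_colouring f"
  shows "r - 1 \<le> card (cls f 0)"
proof -
  have "card (V - (\<Union>i\<in>{1..r}. cls f i)) \<ge> r - 1"
    using alexander assms unfolding alexander_tuple_def face_colouring_def by blast
  moreover have "V - (\<Union>i\<in>{1..r}. cls f i) = cls f 0"
    using assms by (auto simp: cls_def face_colouring_def not_less_eq_eq)
  ultimately show ?thesis by simp
qed

lemma cls_upd: "x \<in> V \<Longrightarrow> cls (f(x := j)) k = (if k = j then insert x (cls f k) else cls f k - {x})"
  by (auto simp: cls_def)

text \<open>The hypothesis \<open>r \<ge> 3\<close> enters here: excluding two colours leaves a
  third, whose class serves as a witness.\<close>

lemma obtain_colour:
  obtains l where "l \<in> {1..r}" "l \<noteq> a" "l \<noteq> b"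
proof -
  have "\<not> {1..r} \<subseteq> {a, b}"
    using card_mono[of "{a, b}" "{1..r}"] card_insert_le_m1[of 2 "{b}" a] r_ge_3 by auto
  then show ?thesis using that by blast
qed

lemma face_colouring_upd:
  assumes "face_colouring f" "x \<in> V" "j \<in> {1..r}" "insert x (cls f j) \<in> K j"
  shows "face_colouring (f(x := j))"
  using assms by (auto simp: face_colouring_def cls_upd intro: face_subset)

text \<open>Take a face colouring with the fewest uncovered vertices. If \<open>r\<close> of them
  were left, a different one could be put into each class. The enlarged classes are still disjoint,
  so unavoidability makes one of them a face, against minimality.\<close>

lemma ex_full: "\<exists>f. full f"
proof -
  have "face_colouring (\<lambda>_. 0)"
    using empty_face by (auto simp: face_colouring_def cls_def)
  then obtain f where f: "face_colouring f"
    and min: "\<And>g. face_colouring g \<Longrightarrow> card (cls f 0) \<le> card (cls g 0)"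
    using ex_has_least_nat[of face_colouring _ "\<lambda>f. card (cls f 0)"] by blast
  have "card (cls f 0) < r"
  proof (rule ccontr)
    assume "\<not> ?thesis"
    then obtain v where v: "v ` {1..r} \<subseteq> cls f 0" "inj_on v {1..r}"
      using card_le_inj[of "{1..r}" "cls f 0"] by auto
    have "\<exists>i\<in>{1..r}. insert (v i) (cls f i) \<in> K i"
    proof (rule unavoidable)
      show "disjoint_family_on (\<lambda>i. insert (v i) (cls f i)) {1..r}"
        using v unfolding disjoint_family_on_def cls_def inj_on_def by fastforce
    qed (use v in \<open>auto simp: cls_def image_subset_iff\<close>)
    then obtain i where i: "i \<in> {1..r}" "insert (v i) (cls f i) \<in> K i" by blast
    have vi: "v i \<in> cls f 0" "v i \<in> V" using v i(1) by (auto simp: cls_def image_subset_iff)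
    have "cls (f(v i := i)) 0 = cls f 0 - {v i}"
      using i(1) vi by (simp add: cls_upd)
    then have "card (cls f 0) \<le> card (cls f 0 - {v i})"
      using min[OF face_colouring_upd[OF f vi(2) i]] by (simp only:)
    then show False
      using card_Diff1_less[OF finite_cls vi(1)] by linarith
  qed
  then show ?thesis
    using card_uncovered_ge[OF f] f unfolding full_def by (intro exI[of _ f]) auto
qed

lemma full_uncovered: "full f \<Longrightarrow> \<exists>v\<in>V. f v = 0"
  using r_ge_3 card_gt_0_iff[of "cls f 0"] by (auto simp: full_def cls_def)

text \<open>Giving \<open>v\<close> the colour \<open>i\<close> would leave only
  \<open>r - 2\<close> vertices uncovered, fewer than an Alexander tuple allows.\<close>

lemma full_maximal:
  assumes "full f" "v \<in> V" "f v = 0" "i \<in> {1..r}"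
  shows "insert v (cls f i) \<notin> K i"
proof
  assume "insert v (cls f i) \<in> K i"
  then have "r - 1 \<le> card (cls (f(v := i)) 0)"
    using assms by (intro card_uncovered_ge face_colouring_upd) (auto simp: full_def)
  also have "\<dots> = card (cls f 0 - {v})"
    using assms by (simp add: cls_upd)
  also have "\<dots> < card (cls f 0)"
    using assms by (intro card_Diff1_less finite_cls) (simp add: cls_def)
  finally show False using assms by (simp add: full_def)
qed

lemma card_cls_0_exchange:
  assumes "x \<in> V" "v \<in> V" "f x \<noteq> 0" "f v = 0"
  shows "card (cls (f(x := 0, v := f x)) 0) = card (cls f 0)"
proof -
  have "cls (f(x := 0, v := f x)) 0 = insert x (cls f 0 - {v})"
    using assms by (auto simp: cls_def)
  moreover have "v \<in> cls f 0" "x \<notin> cls f 0" using assms by (auto simp: cls_def)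
  ultimately show ?thesis by (simp only: card_exchange finite_cls not_False_eq_True)
qed

section \<open>Moving versus exchanging a covered vertex\<close>

lemma exchange_or_addable:
  assumes f: "full f" and x: "x \<in> V" "f x \<noteq> 0" and v: "v \<in> V" "f v = 0"
    and j: "j \<in> {1..r}" "j \<noteq> f x" and nadd: "insert x (cls f j) \<notin> K j"
  shows "full (f(x := 0, v := f x))"
proof -
  let ?i = "f x"
  let ?g = "f(x := 0, v := f x)"
  have i: "?i \<in> {1..r}" using f x by (auto simp: full_def face_colouring_def)
  have clsg: "cls ?g ?i = insert v (cls f ?i - {x})"
    using x v by (auto simp: cls_def)
  have exch: "cls ?g ?i \<in> K ?i"
  proof (rule ccontr)
    assume n: "cls ?g ?i \<notin> K ?i"
    \<comment> \<open>There are as many colours besides \<open>?i\<close> and \<open>j\<close> as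
      uncovered vertices besides \<open>v\<close>, so each such colour \<open>k\<close> gets its own
      vertex \<open>w k\<close>.\<close>
    have "card ({1..r} - {?i, j}) = r - 2"
      using i j by (subst card_Diff_subset) auto
    moreover have "card (cls f 0 - {v}) = r - 2"
      using f v by (simp add: full_def cls_def)
    ultimately obtain w where w: "w ` ({1..r} - {?i, j}) \<subseteq> cls f 0 - {v}"
      "inj_on w ({1..r} - {?i, j})"
      using card_le_inj[of "{1..r} - {?i, j}" "cls f 0 - {v}"] by auto
    \<comment> \<open>No set of this family is a face: at \<open>?i\<close> and \<open>j\<close> by
      assumption, elsewhere by maximality of \<open>f\<close>. Its disjointness then contradicts
      unavoidability.\<close>
    define A where "A k = (if k = ?i then cls ?g ?i else if k = j then insert x (cls f j)
      else insert (w k) (cls f k))" for k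
    have wk: "w k \<in> V" "f (w k) = 0" "w k \<noteq> v" if "k \<in> {1..r}" "k \<noteq> ?i" "k \<noteq> j" for k
      using w(1) that by (auto simp: cls_def image_subset_iff)
    have "\<exists>k\<in>{1..r}. A k \<in> K k"
    proof (rule unavoidable)
      show "A k \<subseteq> V" if "k \<in> {1..r}" for k
        using wk[OF that] x v by (auto simp: A_def cls_def)
      \<comment> \<open>Disjointness holds because \<open>c\<close> recovers from a vertex the only
        index \<open>k\<close> for which it can lie in \<open>A k\<close>.\<close>
      define c where "c y = (if y = v then ?i else if y = x then j else if f y = 0
        then the_inv_into ({1..r} - {?i, j}) w y else f y)" for y
      have "c y = k" if "k \<in> {1..r}" "y \<in> A k" for k y
        using that wk[OF that(1)] x v j i the_inv_into_f_f[OF w(2), of k]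
        unfolding A_def c_def clsg by (auto simp: cls_def split: if_splits)
      then show "disjoint_family_on A {1..r}"
        unfolding disjoint_family_on_def by blast
    qed
    then obtain k where k: "k \<in> {1..r}" "A k \<in> K k" by blast
    show False
    proof (cases "k = ?i \<or> k = j")
      case True
      then show False using k n nadd j by (auto simp: A_def)
    next
      case False
      then show False
        using k wk[of k] full_maximal[OF f, of "w k" k] by (auto simp: A_def)
    qed
  qed
  have "cls ?g k \<subseteq> cls f k" if "k \<noteq> 0" "k \<noteq> ?i" for k
    using that by (auto simp: cls_def split: if_splits)
  then have "cls ?g k \<in> K k" if "k \<in> {1..r}" for k
    using that f exch face_subset[of k "cls f k"]
    by (cases "k = ?i") (auto simp: full_def face_colouring_def)
  moreover have "\<forall>y\<in>V. ?g y \<le> r" using f i by (simp add: full_def face_colouring_def)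
  ultimately have "face_colouring ?g"
    unfolding face_colouring_def by blast
  then show ?thesis
    using card_cls_0_exchange[OF x(1) v(1) x(2) v(2)] f by (simp add: full_def)
qed

text \<open>The exchange uncovers \<open>x\<close> without enlarging class \<open>j\<close>, so
  \<open>x\<close> could still be added there, against maximality of the new colouring.\<close>

lemma not_exchange_and_addable:
  assumes f: "full f" and x: "x \<in> V" "f x \<noteq> 0" and v: "v \<in> V" "f v = 0"
    and j: "j \<in> {1..r}" "j \<noteq> f x" and add: "insert x (cls f j) \<in> K j"
  shows "\<not> full (f(x := 0, v := f x))"
proof
  assume g: "full (f(x := 0, v := f x))" (is "full ?g")
  have "cls ?g j \<subseteq> cls f j" using j v by (auto simp: cls_def)
  then have "insert x (cls ?g j) \<in> K j"
    using face_subset[OF j(1) add] by blast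
  moreover have "?g x = 0" using x v by auto
  ultimately show False using full_maximal[OF g x(1) _ j(1)] by blast
qed

text \<open>Fix an uncovered \<open>v\<close>. Addability to class \<open>j\<close> rules out
  exchanging \<open>x\<close> with \<open>v\<close>, and this failure forces addability to every
  other class.\<close>

lemma in_free_iff:
  assumes f: "full f" and x: "x \<in> V" "f x \<noteq> 0" and j: "j \<in> {1..r}" "j \<noteq> f x"
  shows "x \<in> free f \<longleftrightarrow> insert x (cls f j) \<in> K j"
proof
  assume add: "insert x (cls f j) \<in> K j"
  obtain v where v: "v \<in> V" "f v = 0" using full_uncovered[OF f] by blast
  have "insert x (cls f k) \<in> K k" if k: "k \<in> {1..r}" for k
  proof (cases "k = f x")
    case True
    then have "insert x (cls f k) = cls f k" using x by (auto simp: cls_def)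
    then show ?thesis using f k by (auto simp: full_def face_colouring_def)
  next
    case False
    then show ?thesis
      using exchange_or_addable[OF f x v k] not_exchange_and_addable[OF f x v j add] by blast
  qed
  then show "x \<in> free f" using x by (simp add: free_def)
qed (use j in \<open>simp add: free_def\<close>)

section \<open>Invariance of the set of free vertices\<close>

text \<open>Only class \<open>j\<close> may grow. A colour different from \<open>j\<close> and
  \<open>g z\<close> has a class that did not grow, and by \<open>in_free_iff\<close> this one class
  certifies that \<open>z\<close> is free for \<open>g\<close>.\<close>

lemma free_mono:
  assumes "full g" "\<And>z. z \<in> free f \<Longrightarrow> g z \<noteq> 0" "\<And>l. l \<in> {1..r} \<Longrightarrow> l \<noteq> j \<Longrightarrow> cls g l \<subseteq> cls f l"
  shows "free f \<subseteq> free g"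
proof
  fix z assume z: "z \<in> free f"
  obtain l where l: "l \<in> {1..r}" "l \<noteq> g z" "l \<noteq> j" by (rule obtain_colour)
  have "insert z (cls f l) \<in> K l" using z l by (simp add: free_def)
  then have "insert z (cls g l) \<in> K l" using face_subset[OF l(1)] assms(3)[of l] l by blast
  then show "z \<in> free g"
    using in_free_iff[OF assms(1) _ _ l(1,2)] assms(2)[OF z] z by (simp add: free_def)
qed

lemma recolour_subset:
  assumes "full f" "x \<in> free f" "j \<in> {1..r}"
  shows "full (f(x := j)) \<and> free f \<subseteq> free (f(x := j))"
proof -
  have x: "x \<in> V" "f x \<noteq> 0" "insert x (cls f j) \<in> K j" using assms by (auto simp: free_def)
  then have "cls (f(x := j)) 0 = cls f 0" using assms(3) by (auto simp: cls_def)
  then have g: "full (f(x := j))"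
    using assms x by (auto simp: full_def intro: face_colouring_upd)
  moreover have "free f \<subseteq> free (f(x := j))"
    by (rule free_mono[OF g, of _ j]) (use assms x in \<open>auto simp: free_def cls_def\<close>)
  ultimately show ?thesis by blast
qed

lemma recolour:
  assumes "full f" "x \<in> free f" "j \<in> {1..r}"
  shows "full (f(x := j)) \<and> free (f(x := j)) = free f"
proof -
  note g = recolour_subset[OF assms]
  have "f x \<in> {1..r}" using assms by (auto simp: free_def full_def face_colouring_def)
  moreover have "x \<in> free (f(x := j))" using g assms by blast
  \<comment> \<open>Restoring the old colour of \<open>x\<close> is again a recolouring of a free
    vertex and gives back \<open>f\<close>; this yields the reverse inclusion.\<close>
  ultimately have "free (f(x := j)) \<subseteq> free (f(x := j, x := f x))"
    using recolour_subset[of "f(x := j)" x "f x"] g by blast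
  then show ?thesis using g by auto
qed

lemma recolour_set:
  assumes f: "full f" and h: "\<And>x. x \<in> free f \<Longrightarrow> h x \<in> {1..r}"
  shows "full (override_on f h (free f)) \<and> free (override_on f h (free f)) = free f"
proof -
  have "finite D \<Longrightarrow> D \<subseteq> free f \<Longrightarrow>
    full (override_on f h D) \<and> free (override_on f h D) = free f" for D
  proof (induction D rule: finite_induct)
    case (insert x D)
    then show ?case
      using recolour[of "override_on f h D" x "h x"] h
      by (simp only: override_on_insert) (simp add: fun_upd_def)
  qed (use f in simp)
  moreover have "finite (free f)" using finite_V by (simp add: free_def)
  ultimately show ?thesis by blast
qed

lemma exchange_subset:
  assumes f: "full f" and x: "x \<in> V" "x \<notin> free f" "f x \<noteq> 0" and v: "v \<in> V" "f v = 0"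
  shows "full (f(x := 0, v := f x)) \<and> free f \<subseteq> free (f(x := 0, v := f x))"
proof -
  let ?g = "f(x := 0, v := f x)"
  obtain j where j: "j \<in> {1..r}" "j \<noteq> f x" by (rule obtain_colour)
  then have "insert x (cls f j) \<notin> K j" using in_free_iff[OF f x(1,3) j] x by blast
  then have g: "full ?g" using exchange_or_addable[OF f x(1,3) v j] by blast
  moreover have "free f \<subseteq> free ?g"
    by (rule free_mono[OF g, of _ "f x"]) (use x v in \<open>auto simp: free_def cls_def split: if_splits\<close>)
  ultimately show ?thesis by blast
qed

lemma exchange:
  assumes f: "full f" and x: "x \<in> V" "x \<notin> free f" "f x \<noteq> 0" and v: "v \<in> V" "f v = 0"
  shows "full (f(x := 0, v := f x)) \<and> free (f(x := 0, v := f x)) = free f"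
proof -
  let ?g = "f(x := 0, v := f x)"
  note g = exchange_subset[OF assms]
  have gv: "?g v \<noteq> 0" and gx: "?g x = 0" using x v by auto
  have undo: "?g(v := 0, x := ?g v) = f" using x v by auto
  obtain j where j: "j \<in> {1..r}" "j \<noteq> ?g v" by (rule obtain_colour)
  \<comment> \<open>The reverse exchange restores the full colouring \<open>f\<close>, so
    \<open>v\<close> is exchangeable in \<open>?g\<close> and hence not free. The inclusion
    therefore also applies to the reverse exchange.\<close>
  have "v \<notin> free ?g"
    using not_exchange_and_addable[of ?g, OF _ v(1) gv x(1) gx j] in_free_iff[of ?g, OF _ v(1) gv j] g f
    unfolding undo by blast
  then have "free ?g \<subseteq> free f"
    using exchange_subset[of ?g, OF _ v(1) _ gv x(1) gx] g unfolding undo by blast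
  then show ?thesis using g by blast
qed

lemma swap_colours:
  assumes f: "full f" and x: "x \<in> V" "x \<notin> free f" and y: "y \<in> V" "y \<notin> free f"
  shows "full (f(x := f y, y := f x)) \<and> free (f(x := f y, y := f x)) = free f"
proof -
  consider "f x = f y" | "f x \<noteq> 0" "f y = 0" | "f x = 0" "f y \<noteq> 0"
    | "f x \<noteq> f y" "f x \<noteq> 0" "f y \<noteq> 0" by fastforce
  then show ?thesis
  proof cases
    case 1
    then have "f(x := f y, y := f x) = f" by auto
    then show ?thesis using f by simp
  next
    case 2
    then show ?thesis using exchange[OF f x _ y(1)] by simp
  next
    case 3
    then have "f(x := f y, y := f x) = f(y := 0, x := f y)" by auto
    then show ?thesis using exchange[OF f y _ x(1)] 3 by simp
  next
    case 4
    obtain v where v: "v \<in> V" "f v = 0" using full_uncovered[OF f] by blast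
    have ne: "x \<noteq> y" "x \<noteq> v" "y \<noteq> v" using 4 v by auto
    \<comment> \<open>Three exchanges with \<open>v\<close> as intermediate storage:
      \<open>x\<close> passes its colour to \<open>v\<close>, \<open>y\<close> passes its colour to
      \<open>x\<close>, and \<open>v\<close> passes the stored colour to \<open>y\<close>.\<close>
    define f1 where "f1 = f(x := 0, v := f x)"
    define f2 where "f2 = f1(y := 0, x := f1 y)"
    define f3 where "f3 = f2(v := 0, y := f2 v)"
    have 1: "full f1 \<and> free f1 = free f"
      unfolding f1_def using exchange[OF f x _ v] 4 by simp
    have 2: "full f2 \<and> free f2 = free f"
      unfolding f2_def using exchange[of f1 y x] 1 x y 4 ne by (simp add: f1_def)
    have "v \<notin> free f" using v by (simp add: free_def)
    then have 3: "full f3 \<and> free f3 = free f"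
      unfolding f3_def using exchange[of f2 v y] 2 y v 4 ne by (simp add: f1_def f2_def)
    have "f3 = f(x := f y, y := f x)"
      unfolding f3_def f2_def f1_def using ne v by (auto simp: fun_eq_iff)
    then show ?thesis using 3 by simp
  qed
qed

section \<open>Faces are determined by their number of non-free vertices\<close>

text \<open>Swap a vertex of \<open>S\<close> outside class \<open>i\<close> with a non-free vertex
  of class \<open>i\<close> outside \<open>S\<close>, which exists since the cardinalities agree.
  Each swap lowers \<open>card (S - cls f i)\<close> by one.\<close>

lemma ex_full_with_class:
  assumes "full f" "S \<subseteq> V - free f" "card S = card (cls f i - free f)"
  shows "\<exists>g. full g \<and> free g = free f \<and> cls g i - free f = S"
  using assms
proof (induction "card (S - cls f i)" arbitrary: f)
  case 0
  have "finite S" using 0 finite_V finite_subset by blast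
  then have "S \<subseteq> cls f i" using 0 by simp
  then have "S = cls f i - free f" using 0 by (intro card_subset_eq) auto
  then show ?case using 0 by blast
next
  case (Suc n)
  let ?T = "cls f i - free f"
  have finS: "finite S" using Suc finite_V finite_subset by blast
  from Suc obtain y where y: "y \<in> S" "y \<notin> cls f i"
    by (metis Diff_iff card.empty ex_in_conv nat.distinct(1))
  have "\<not> ?T \<subseteq> S"
    using card_subset_eq[OF finS, of ?T] Suc.prems(3) y by auto
  then obtain x where x: "x \<in> ?T" "x \<notin> S" by blast
  have xy: "x \<in> V" "x \<notin> free f" "y \<in> V" "y \<notin> free f" "f x = i" "f y \<noteq> i"
    using x y Suc.prems(2) by (auto simp: cls_def)
  define g where "g = f(x := f y, y := f x)"
  have g: "full g" "free g = free f"
    unfolding g_def using swap_colours[OF Suc.prems(1) xy(1-4)] by blast+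
  have clsg: "cls g i = insert y (cls f i - {x})"
    using xy unfolding g_def by (auto simp: cls_def)
  have "cls g i - free g = insert y (?T - {x})"
    using clsg g xy by auto
  then have "card (cls g i - free g) = card ?T"
    using card_exchange[of ?T x y] x y by (simp only: finite_Diff finite_cls) blast
  moreover have "n = card (S - cls g i)"
  proof -
    have "S - cls g i = (S - cls f i) - {y}" using clsg x by auto
    then show ?thesis using Suc.hyps(2) y by simp
  qed
  ultimately show ?case
    using Suc.hyps(1)[of g] g Suc.prems by simp
qed

text \<open>If \<open>F\<close> had too many non-free vertices, a subset of them would arise from a
  class \<open>i\<close> by adding an uncovered vertex, against maximality. Conversely, a set within
  the bound lies in class \<open>i\<close> of a suitable full colouring.\<close>

lemma face_iff:
  assumes f: "full f" and i: "i \<in> {1..r}"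
  shows "F \<in> K i \<longleftrightarrow> F \<subseteq> V \<and> card (F - free f) \<le> card (cls f i - free f)"
proof
  assume F: "F \<in> K i"
  then have FV: "F \<subseteq> V" using face_subset_V i by blast
  have "card (F - free f) \<le> card (cls f i - free f)"
  proof (rule ccontr)
    assume "\<not> ?thesis"
    then obtain S' where S': "S' \<subseteq> F - free f" "card S' = Suc (card (cls f i - free f))"
      by (metis not_less_eq_eq obtain_subset_with_card_n)
    then obtain v where v: "v \<in> S'" by fastforce
    have vV: "v \<in> V" "v \<notin> free f" using v S' FV by auto
    have "S' - {v} \<subseteq> V - free f" using S' FV by blast
    moreover have "card (S' - {v}) = card (cls f i - free f)" using S' v by simp
    ultimately obtain g where g: "full g" "free g = free f" "cls g i - free f = S' - {v}"
      using ex_full_with_class[OF f] by blast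
    obtain w where w: "w \<in> V" "g w = 0" using full_uncovered[OF g(1)] by blast
    have wf: "w \<notin> free g" using w by (simp add: free_def)
    \<comment> \<open>The swap makes \<open>v\<close> uncovered and leaves class \<open>i\<close>
      alone, since neither \<open>g v\<close> nor \<open>g w\<close> equals
      \<open>i\<close>.\<close>
    define h where "h = g(v := g w, w := g v)"
    have h: "full h" "free h = free f"
      unfolding h_def using swap_colours[OF g(1), of v w] vV w wf g(2) by auto
    have hv: "h v = 0" using w by (simp add: h_def)
    have "v \<notin> cls g i - free f" using g(3) by blast
    then have "g v \<noteq> i" using vV by (simp add: cls_def)
    then have hi: "cls h i = cls g i"
      using w i by (auto simp: h_def cls_def)
    obtain j where j: "j \<in> {1..r}" "j \<noteq> i" by (rule obtain_colour)
    \<comment> \<open>Moving all free vertices to another colour makes class \<open>i\<close>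
      exactly \<open>S' - {v}\<close>.\<close>
    define k where "k = override_on h (\<lambda>_. j) (free h)"
    have k: "full k" unfolding k_def using recolour_set[OF h(1), of "\<lambda>_. j"] j by blast
    have kv: "k v = 0" using hv vV h by (simp add: k_def)
    have "cls k i = cls h i - free h"
      using j by (auto simp: k_def cls_def override_on_def split: if_splits)
    then have "insert v (cls k i) = S'" using g h hi v by auto
    then have "S' \<notin> K i" using full_maximal[OF k vV(1) kv i] by simp
    then show False using face_subset[OF i F, of S'] S' by blast
  qed
  then show "F \<subseteq> V \<and> card (F - free f) \<le> card (cls f i - free f)" using FV by blast
next
  assume F: "F \<subseteq> V \<and> card (F - free f) \<le> card (cls f i - free f)"
  have "card (cls f i - free f) \<le> card (V - free f)"
    using finite_V by (intro card_mono) (auto simp: cls_def)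
  then obtain S where S: "F - free f \<subseteq> S" "S \<subseteq> V - free f" "card S = card (cls f i - free f)"
    using exists_subset_between[of "F - free f" "card (cls f i - free f)" "V - free f"]
      F finite_V by blast
  then obtain g where g: "full g" "free g = free f" "cls g i - free f = S"
    using ex_full_with_class[OF f] by blast
  \<comment> \<open>With all free vertices in class \<open>i\<close>, this class contains
    \<open>S\<close> together with \<open>free f\<close>, hence \<open>F\<close>.\<close>
  define k where "k = override_on g (\<lambda>_. i) (free g)"
  have k: "full k" unfolding k_def using recolour_set[OF g(1), of "\<lambda>_. i"] i by blast
  have "F \<subseteq> cls k i"
  proof
    fix z assume z: "z \<in> F"
    show "z \<in> cls k i"
    proof (cases "z \<in> free f")
      case True
      then show ?thesis using z F g by (auto simp: k_def cls_def)
    next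
      case False
      then have "z \<in> cls g i" using z S g by blast
      then show ?thesis using False g by (simp add: k_def cls_def)
    qed
  qed
  moreover have "cls k i \<in> K i" using k i by (simp add: full_def face_colouring_def)
  ultimately show "F \<in> K i" by (rule face_subset[OF i, rotated])
qed

text \<open>Uncovered vertices are never free, so they contribute the summand \<open>r - 1\<close>.
  This is the formula for \<open>n\<close> in the theorem.\<close>

lemma card_not_free:
  assumes "full f"
  shows "card (V - free f) = (\<Sum>i=1..r. card (cls f i - free f)) + (r - 1)"
proof -
  have "V - free f = cls f 0 \<union> (\<Union>i\<in>{1..r}. cls f i - free f)"
    using assms by (auto simp: cls_def free_def full_def face_colouring_def not_less_eq_eq)
  also have "card \<dots> = card (cls f 0) + card (\<Union>i\<in>{1..r}. cls f i - free f)"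
    by (intro card_Un_disjoint) (auto simp: cls_def finite_V)
  also have "card (\<Union>i\<in>{1..r}. cls f i - free f) = (\<Sum>i=1..r. card (cls f i - free f))"
    by (intro card_UN_disjoint) (auto simp: cls_def finite_V)
  finally show ?thesis using assms by (simp add: full_def)
qed

end

section \<open>Transport to standard vertices, small \<open>r\<close>, and the
  classification\<close>

lemma image_bounded_faces:
  assumes \<phi>: "bij_betw \<phi> (V - B) {1..n}" "bij_betw \<phi> B C" "inj_on \<phi> V" and B: "B \<subseteq> V"
  shows "(`) \<phi> ` {F. F \<subseteq> V \<and> card (F - B) \<le> m} = join (subsets_upto n m) (Pow C)"
proof (rule set_eqI iffI)+
  fix G assume "G \<in> (`) \<phi> ` {F. F \<subseteq> V \<and> card (F - B) \<le> m}"
  then obtain F where F: "G = \<phi> ` F" "F \<subseteq> V" "card (F - B) \<le> m" by blast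
  have "card (\<phi> ` (F - B)) \<le> m"
    using F by (subst card_image) (auto intro: inj_on_subset[OF \<phi>(3)])
  moreover have "\<phi> ` (F - B) \<subseteq> {1..n}" "\<phi> ` (F \<inter> B) \<subseteq> C"
    using F \<phi>(1,2) by (auto simp: bij_betw_def)
  moreover have "G = \<phi> ` (F - B) \<union> \<phi> ` (F \<inter> B)" using F by blast
  ultimately show "G \<in> join (subsets_upto n m) (Pow C)"
    unfolding join_def subsets_upto_def by blast
next
  fix G assume "G \<in> join (subsets_upto n m) (Pow C)"
  then obtain P Q where PQ: "G = P \<union> Q" "P \<subseteq> {1..n}" "card P \<le> m" "Q \<subseteq> C"
    unfolding join_def subsets_upto_def by blast
  obtain P' where P': "P' \<subseteq> V - B" "P = \<phi> ` P'"
    using PQ(2) \<phi>(1) unfolding bij_betw_def by (metis subset_imageE)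
  obtain Q' where Q': "Q' \<subseteq> B" "Q = \<phi> ` Q'"
    using PQ(4) \<phi>(2) unfolding bij_betw_def by (metis subset_imageE)
  have "inj_on \<phi> P'" using P' by (auto intro: inj_on_subset[OF \<phi>(3)])
  then have "card P' \<le> m" using PQ(3) P' by (simp add: card_image)
  moreover have "(P' \<union> Q') - B = P'" using P' Q' by blast
  moreover have "P' \<union> Q' \<subseteq> V" using P' Q' B by blast
  moreover have "G = \<phi> ` (P' \<union> Q')" using PQ P' Q' by blast
  ultimately show "G \<in> (`) \<phi> ` {F. F \<subseteq> V \<and> card (F - B) \<le> m}"
    by (intro image_eqI[of _ _ "P' \<union> Q'"]) auto
qed

text \<open>Apply both halves of the Alexander property to the pair \<open>V - F\<close>,
  \<open>F\<close>. It is disjoint, so one member is a face of its complex; it covers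
  \<open>V\<close>, so not both are.\<close>

lemma alexander_pair_dual:
  assumes "alexander_tuple V 2 K" "K 1 \<subseteq> Pow V" "K 2 \<subseteq> Pow V"
  shows "K 2 = alexander_dual V (K 1)"
proof -
  have *: "{1..2} = {1, 2 :: nat}" by auto
  have "V - F \<notin> K 1" if F: "F \<in> K 2" for F
  proof
    assume "V - F \<in> K 1"
    then have "1 \<le> card (V - (\<Union>i\<in>{1, 2 :: nat}. if i = 1 then V - F else F))"
      using assms(1) F unfolding alexander_tuple_def *
      by (elim conjE allE[of _ "\<lambda>i. if i = 1 then V - F else F"]) auto
    moreover have "V - (\<Union>i\<in>{1, 2 :: nat}. if i = 1 then V - F else F) = {}" by auto
    ultimately show False by (simp only: card.empty)
  qed
  moreover have "F \<in> K 2" if F: "F \<subseteq> V" "V - F \<notin> K 1" for F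
  proof -
    have "\<exists>i\<in>{1, 2 :: nat}. (if i = 1 then V - F else F) \<in> K i"
      using assms(1) F(1) unfolding alexander_tuple_def collective_unavoidable_def *
      by (elim conjE allE[of _ "\<lambda>i. if i = 1 then V - F else F"])
        (auto simp: disjoint_family_on_def)
    then show ?thesis using F by auto
  qed
  ultimately show ?thesis using assms(3) unfolding alexander_dual_def by blast
qed

text \<open>For \<open>r \<le> 1\<close> the family with constant value \<open>V\<close> counts as
  disjoint, so unavoidability makes \<open>V\<close> itself a face, against properness.\<close>

lemma proper_alexander_tuple_ge_2:
  assumes "\<And>i. i \<in> {1..r} \<Longrightarrow> simplicial_complex V (K i)" "\<And>i. i \<in> {1..r} \<Longrightarrow> K i \<subset> Pow V"
    and "alexander_tuple V r K"
  shows "r \<ge> 2"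
proof (rule ccontr)
  assume r: "\<not> r \<ge> 2"
  then have "(\<forall>i\<in>{1..r}. V \<subseteq> V) \<and> disjoint_family_on (\<lambda>_. V) {1..r}"
    by (auto simp: disjoint_family_on_def)
  then obtain i where i: "i \<in> {1..r}" "V \<in> K i"
    using assms(3) unfolding alexander_tuple_def collective_unavoidable_def
    by (elim conjE allE[of _ "\<lambda>_. V"]) blast
  then have "Pow V \<subseteq> K i" using assms(1)[OF i(1)] unfolding simplicial_complex_def by blast
  then show False using assms(2)[OF i(1)] by blast
qed

theorem theorem5p1:
  fixes V :: "'a set" and r :: nat and K :: "nat \<Rightarrow> 'a set set"
  assumes "finite V"
    and "\<And>i. i \<in> {1..r} \<Longrightarrow> simplicial_complex V (K i)"
    and "\<And>i. i \<in> {1..r} \<Longrightarrow> K i \<subset> Pow V"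
    and "alexander_tuple V r K"
  shows "(r = 2 \<and> K 2 = alexander_dual V (K 1)) \<or>
    (r \<ge> 3 \<and>
      (\<exists>(n::nat) (m :: nat \<Rightarrow> nat) (\<phi> :: 'a \<Rightarrow> nat).
         n = card V \<and> bij_betw \<phi> V {1..n} \<and>
         n = (\<Sum>i=1..r. m i) + (r - 1) \<and>
         (\<forall>i\<in>{1..r}. (`) \<phi> ` K i = subsets_upto n (m i)))) \<or>
    (r \<ge> 3 \<and>
      (\<exists>(n::nat) (C :: nat set) (m :: nat \<Rightarrow> nat) (\<phi> :: 'a \<Rightarrow> nat).
         C \<noteq> {} \<and> C \<inter> {1..n} = {} \<and> bij_betw \<phi> V ({1..n} \<union> C) \<and>
         n = (\<Sum>i=1..r. m i) + (r - 1) \<and>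
         (\<forall>i\<in>{1..r}. (`) \<phi> ` K i = join (subsets_upto n (m i)) (Pow C))))"
proof -
  consider "r = 2" | "r \<ge> 3"
    using proper_alexander_tuple_ge_2[OF assms(2-4)] by linarith
  then show ?thesis
  proof cases
    case 1
    then show ?thesis
      using alexander_pair_dual[of V K] assms(3)[of 1] assms(3)[of 2] assms(4) by auto
  next
    case r: 2
    interpret alexander_complexes V r K
      using assms(1,2,4) r by unfold_locales
    obtain f where f: "full f" using ex_full by blast
    define B where "B = free f"
    define n where "n = card (V - B)"
    \<comment> \<open>The labels for free vertices start right after \<open>n\<close>, which keeps
      them disjoint from \<open>{1..n}\<close>.\<close>
    define C where "C = {n + 1..n + card B}"
    define m where "m i = card (cls f i - B)" for i
    have BV: "B \<subseteq> V" by (auto simp: B_def free_def)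
    then have fin: "finite B" "finite (V - B)" using assms(1) finite_subset by auto
    have "card (V - B) = card {1..n}" "card B = card C" by (simp_all add: n_def C_def)
    then obtain \<phi>1 \<phi>2 where \<phi>1: "bij_betw \<phi>1 (V - B) {1..n}" and \<phi>2: "bij_betw \<phi>2 B C"
      using finite_same_card_bij fin unfolding C_def by (metis finite_atLeastAtMost)
    define \<phi> where "\<phi> = override_on \<phi>1 \<phi>2 B"
    have 1: "bij_betw \<phi> (V - B) {1..n}"
      using \<phi>1 by (subst bij_betw_cong[of _ _ \<phi>1]) (auto simp: \<phi>_def)
    have 2: "bij_betw \<phi> B C"
      using \<phi>2 by (subst bij_betw_cong[of _ _ \<phi>2]) (auto simp: \<phi>_def)
    have disj: "C \<inter> {1..n} = {}" by (auto simp: C_def)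
    have bij: "bij_betw \<phi> V ({1..n} \<union> C)"
      using bij_betw_combine[OF 1 2] disj BV by (auto simp: Un_absorb2 Int_commute)
    have n: "n = (\<Sum>i=1..r. m i) + (r - 1)"
      using card_not_free[OF f] by (simp add: n_def m_def B_def)
    have K: "(`) \<phi> ` K i = join (subsets_upto n (m i)) (Pow C)" if "i \<in> {1..r}" for i
    proof -
      have "K i = {F. F \<subseteq> V \<and> card (F - B) \<le> m i}"
        using face_iff[OF f that] by (auto simp: B_def m_def)
      then show ?thesis
        using image_bounded_faces[OF 1 2 _ BV] bij by (simp add: bij_betw_def)
    qed
    show ?thesis
    \<comment> \<open>Without free vertices the simplex factor is \<open>{{}}\<close> and the join
      collapses to the skeleton; otherwise the free vertices span the simplex on
      \<open>C\<close>.\<close>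
    proof (cases "B = {}")
      case True
      then have "C = {}" by (simp add: C_def)
      then have "(`) \<phi> ` K i = subsets_upto n (m i)" if "i \<in> {1..r}" for i
        using K[OF that] by (simp add: join_def)
      moreover have "n = card V" using True by (simp add: n_def)
      moreover have "bij_betw \<phi> V {1..n}" using bij \<open>C = {}\<close> by simp
      ultimately show ?thesis using r n by (intro disjI2[OF disjI1] conjI exI[of _ n] exI[of _ m] exI[of _ \<phi>]) auto
    next
      case False
      then have "C \<noteq> {}" using fin by (simp add: C_def card_gt_0_iff Suc_le_eq)
      then show ?thesis using r n disj bij K
        by (intro disjI2 conjI exI[of _ n] exI[of _ C] exI[of _ m] exI[of _ \<phi>] ballI)
    qed
  qed
qed

end
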